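(* Let $W=S_n$ and let $(X,Y)$ be an arbitrary splitting of $W$. Then $X=W/Y$ and $Y=[e,u]_R$ for some separable permutation $u\in S_n$.
   Context: $S_n$ is the symmetric group, with product $(uv)(i)=u(v(i))$, viewed as the Weyl group of type $A_{n-1}$ generated by adjacent transpositions $s_i=(i,i+1)$. The length $\ell(w)$ is the number of inversions $\{(i,j):i<j,\ w(i)>w(j)\}$. Right weak order: $v\leq_R w$ iff $w=vz$ with $\ell(w)=\ell(v)+\ell(z)$; $[e,u]_R=\{v: v\leq_R u\}$. A permutation is separable if it avoids the patterns $3142$ and $2413$, i.e. there are no indices $i_1<i_2<i_3<i_4$ with $w(i_1)w(i_2)w(i_3)w(i_4)$ in the same relative order as $3142$ or $2413$. For $U\subseteq W$, the generalized quotient is $W/U=\{w\in W:\ell(wu)=\ell(w)+\ell(u)\ \forall u\in U\}$. A pair $(X,Y)$ of subsets of $W$ is a splitting if the multiplication map $X\times Y\to W$, $(x,y)\mapsto xy$, is a bijection with $\ell(xy)=\ell(x)+\ell(y)$ for all $x\in X,y\in Y$. *)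

theory Defs
  imports "HOL-Combinatorics.Permutations"
begin

text \<open>The symmetric group S_n: permutations of {1..n}, with product (u v)(i) = u (v i),
  i.e. function composition u \<circ> v.\<close>
definition Sym :: "nat \<Rightarrow> (nat \<Rightarrow> nat) set" where
  "Sym n = {p. p permutes {1..n}}"

text \<open>Coxeter length = number of inversions.\<close>
definition len :: "nat \<Rightarrow> (nat \<Rightarrow> nat) \<Rightarrow> nat" where
  "len n w = card {(i, j). i \<in> {1..n} \<and> j \<in> {1..n} \<and> i < j \<and> w i > w j}"

definition right_le :: "nat \<Rightarrow> (nat \<Rightarrow> nat) \<Rightarrow> (nat \<Rightarrow> nat) \<Rightarrow> bool" where
  "right_le n v w \<longleftrightarrow> v \<in> Sym n \<and> w \<in> Sym n \<and>
     (\<exists>z \<in> Sym n. w = v \<circ> z \<and> len n w = len n v + len n z)"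

definition right_interval :: "nat \<Rightarrow> (nat \<Rightarrow> nat) \<Rightarrow> (nat \<Rightarrow> nat) set" where
  "right_interval n u = {v. right_le n v u}"

text \<open>Separable: avoids the patterns 3142 and 2413.\<close>
definition separable :: "nat \<Rightarrow> (nat \<Rightarrow> nat) \<Rightarrow> bool" where
  "separable n w \<longleftrightarrow> \<not> (\<exists>i1 i2 i3 i4. 1 \<le> i1 \<and> i1 < i2 \<and> i2 < i3 \<and> i3 < i4 \<and> i4 \<le> n \<and>
     ((w i2 < w i4 \<and> w i4 < w i1 \<and> w i1 < w i3) \<or>
      (w i3 < w i1 \<and> w i1 < w i4 \<and> w i4 < w i2)))"

definition gen_quotient :: "nat \<Rightarrow> (nat \<Rightarrow> nat) set \<Rightarrow> (nat \<Rightarrow> nat) set" where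
  "gen_quotient n U = {w \<in> Sym n. \<forall>u \<in> U. len n (w \<circ> u) = len n w + len n u}"

definition splitting :: "nat \<Rightarrow> (nat \<Rightarrow> nat) set \<Rightarrow> (nat \<Rightarrow> nat) set \<Rightarrow> bool" where
  "splitting n X Y \<longleftrightarrow> X \<subseteq> Sym n \<and> Y \<subseteq> Sym n \<and>
     bij_betw (\<lambda>(x, y). x \<circ> y) (X \<times> Y) (Sym n) \<and>
     (\<forall>x \<in> X. \<forall>y \<in> Y. len n (x \<circ> y) = len n x + len n y)"

end

theory Submission
  imports Defs
begin

text \<open>
  A product \<open>x \<circ> y\<close> is reduced iff no pair \<open>i < j\<close> is inverted by both \<open>x\<close> and \<open>inv y\<close>.
  Writing the longest element as \<open>x\<^sub>0 \<circ> u\<close> in a splitting \<open>(X, Y)\<close>, the pairs inverted by \<open>x\<^sub>0\<close>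
  and by \<open>inv u\<close> are complementary, which bounds \<open>Y\<close> above by \<open>[e,u]\<^sub>R\<close> and \<open>X\<close> above by
  \<open>W/[e,u]\<^sub>R\<close>.

  If \<open>u\<close> is separable, the product map is injective on these two upper bounds (induction along
  the decomposition of \<open>u\<close> into direct and skew sums), so both bounds are attained.

  If \<open>u\<close> is not separable in a minimal counterexample, splittings can be restricted to the
  parabolic subgroups that fix the least or the greatest value. The same applies to the splittings
  \<open>(w\<^sub>0 X u, u\<^sup>-\<^sup>1 Y)\<close> and \<open>(Y\<^sup>-\<^sup>1, X\<^sup>-\<^sup>1)\<close>. Hence every forbidden pattern in \<open>u\<close> uses the extreme
  values and the extreme positions, and (up to the last symmetry) \<open>u\<close> has the one-line form
  \<open>n-1, 1, \<dots>, n, 2\<close>. Then the 4-cycle with one-line form \<open>n-1, 1, 3, \<dots>, n-2, n, 2\<close> is forced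
  to lie in both \<open>X\<close> and \<open>Y\<close>, contradicting the uniqueness of factorizations.
\<close>

section \<open>Separable permutations\<close>

text \<open>Positions range over an arbitrary set so that inductions can pass to subsets, and values
  over any linear order so that integer values can be negated, which exchanges the two
  patterns.\<close>

definition pattern_2413 :: "(nat \<Rightarrow> 'a::linorder) \<Rightarrow> nat set \<Rightarrow> bool" where
  "pattern_2413 v A \<longleftrightarrow> (\<exists>i\<in>A. \<exists>j\<in>A. \<exists>k\<in>A. \<exists>l\<in>A.
     i < j \<and> j < k \<and> k < l \<and> v k < v i \<and> v i < v l \<and> v l < v j)"

definition pattern_3142 :: "(nat \<Rightarrow> 'a::linorder) \<Rightarrow> nat set \<Rightarrow> bool" where
  "pattern_3142 v A \<longleftrightarrow> (\<exists>i\<in>A. \<exists>j\<in>A. \<exists>k\<in>A. \<exists>l\<in>A.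
     i < j \<and> j < k \<and> k < l \<and> v j < v l \<and> v l < v i \<and> v i < v k)"

definition separable_on :: "nat set \<Rightarrow> (nat \<Rightarrow> 'a::linorder) \<Rightarrow> bool" where
  "separable_on A v \<longleftrightarrow> \<not> pattern_2413 v A \<and> \<not> pattern_3142 v A"

lemma separable_on_subset: "separable_on A v \<Longrightarrow> B \<subseteq> A \<Longrightarrow> separable_on B v"
  unfolding separable_on_def pattern_2413_def pattern_3142_def by blast

lemma pattern_uminus:
  fixes v :: "nat \<Rightarrow> int"
  shows "pattern_2413 (\<lambda>i. - v i) A \<longleftrightarrow> pattern_3142 v A"
    and "pattern_3142 (\<lambda>i. - v i) A \<longleftrightarrow> pattern_2413 v A"
  unfolding pattern_2413_def pattern_3142_def by auto

lemma separable_on_of_nat: "separable_on A (\<lambda>i. int (v i)) \<longleftrightarrow> separable_on A v"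
  unfolding separable_on_def pattern_2413_def pattern_3142_def by auto

lemma pattern_cong:
  assumes "\<And>i j. i \<in> A \<Longrightarrow> j \<in> A \<Longrightarrow> v i < v j \<longleftrightarrow> w i < w j"
  shows "pattern_2413 v A \<longleftrightarrow> pattern_2413 w A" "pattern_3142 v A \<longleftrightarrow> pattern_3142 w A"
  unfolding pattern_2413_def pattern_3142_def by (simp_all add: assms cong: bex_cong_simp conj_cong)

text \<open>The permutations 3142 and 2413 of four letters are inverse to each other: the values of
  an occurrence, in increasing order, are the positions of an occurrence in the inverse.\<close>

lemma pattern_3142_inv:
  assumes "p permutes A" "pattern_3142 p A"
  shows "pattern_2413 (inv p) A"
proof -
  obtain i j k l where "i \<in> A" "j \<in> A" "k \<in> A" "l \<in> A" "i < j" "j < k" "k < l"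
      "p j < p l" "p l < p i" "p i < p k"
    using assms(2) unfolding pattern_3142_def by blast
  then show ?thesis
    unfolding pattern_2413_def
    by (intro bexI[of _ "p j"] bexI[of _ "p l"] bexI[of _ "p i"] bexI[of _ "p k"])
      (auto simp: permutes_inverses[OF assms(1)] permutes_in_image[OF assms(1)])
qed

lemma pattern_2413_inv:
  assumes "p permutes A" "pattern_2413 p A"
  shows "pattern_3142 (inv p) A"
proof -
  obtain i j k l where "i \<in> A" "j \<in> A" "k \<in> A" "l \<in> A" "i < j" "j < k" "k < l"
      "p k < p i" "p i < p l" "p l < p j"
    using assms(2) unfolding pattern_2413_def by blast
  then show ?thesis
    unfolding pattern_3142_def
    by (intro bexI[of _ "p k"] bexI[of _ "p i"] bexI[of _ "p l"] bexI[of _ "p j"])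
      (auto simp: permutes_inverses[OF assms(1)] permutes_in_image[OF assms(1)])
qed

lemma separable_on_inv:
  assumes "p permutes A"
  shows "separable_on A (inv p) \<longleftrightarrow> separable_on A p"
  using pattern_2413_inv[OF assms] pattern_3142_inv[OF assms]
    pattern_2413_inv[OF permutes_inv[OF assms]] pattern_3142_inv[OF permutes_inv[OF assms]]
  unfolding separable_on_def permutes_inv_inv[OF assms] by blast

text \<open>This is a decomposition into a direct sum of two nonempty blocks. Applied to
  \<open>- v\<close> it is a skew sum, hence the integer values.\<close>

definition sum_cut :: "(nat \<Rightarrow> int) \<Rightarrow> nat set \<Rightarrow> nat \<Rightarrow> bool" where
  "sum_cut v A c \<longleftrightarrow> c \<in> A \<and> (\<exists>i\<in>A. i < c) \<and> (\<forall>i\<in>A. \<forall>j\<in>A. i < c \<and> c \<le> j \<longrightarrow> v i < v j)"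

lemma sum_cut_insert_max:
  assumes cut: "sum_cut v A c" and "finite A" and gt: "\<And>i. i \<in> A \<Longrightarrow> i < m"
    and ne: "\<And>i. i \<in> A \<Longrightarrow> v i \<noteq> v m"
    and no: "\<not> pattern_3142 v (insert m A)"
    and IH: "\<And>B. B \<subseteq> A \<Longrightarrow> 2 \<le> card B \<Longrightarrow> \<exists>c. sum_cut v B c \<or> sum_cut (\<lambda>i. - v i) B c"
  shows "\<exists>c. sum_cut v (insert m A) c \<or> sum_cut (\<lambda>i. - v i) (insert m A) c"
proof -
  \<comment> \<open>With the least cut, the block before \<open>c\<close> is not itself a direct
    sum. This is used below to make its decomposition a skew one.\<close>
  define c where "c = (LEAST c. sum_cut v A c)"
  have c: "sum_cut v A c" and least: "\<And>d. sum_cut v A d \<Longrightarrow> c \<le> d"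
    unfolding c_def using cut by (auto intro: LeastI Least_le)
  have cA: "c \<in> A" and below: "\<exists>i\<in>A. i < c"
    and lt: "\<And>i j. i \<in> A \<Longrightarrow> j \<in> A \<Longrightarrow> i < c \<Longrightarrow> c \<le> j \<Longrightarrow> v i < v j"
    using c unfolding sum_cut_def by auto
  consider (all) "\<forall>i\<in>A. i < c \<longrightarrow> v i < v m" | (none) "\<forall>i\<in>A. v m < v i"
    | (mid) \<alpha> \<beta> where "\<alpha> \<in> A" "\<alpha> < c" "v m < v \<alpha>" "\<beta> \<in> A" "v \<beta> < v m"
    using ne by (meson linorder_neqE)
  then show ?thesis
  proof cases
    case all
    then have "sum_cut v (insert m A) c"
      using cA below lt gt unfolding sum_cut_def by (auto dest: gt)
    then show ?thesis by blast
  next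
    case none
    then have "sum_cut (\<lambda>i. - v i) (insert m A) m"
      using cA gt unfolding sum_cut_def by (auto dest: gt)
    then show ?thesis by blast
  next
    case mid
    \<comment> \<open>The last value lies strictly between two values of the first block, so that
      block has at least two elements and splits by \<open>IH\<close>.\<close>
    have "\<beta> < c" using lt[of \<alpha> \<beta>] mid by force
    let ?B = "{i\<in>A. i < c}"
    have "card {\<alpha>, \<beta>} \<le> card ?B" using mid \<open>\<beta> < c\<close> \<open>finite A\<close> by (intro card_mono) auto
    moreover have "\<alpha> \<noteq> \<beta>" using mid by auto
    ultimately have "2 \<le> card ?B" by simp
    moreover have "?B \<subseteq> A" by auto
    ultimately obtain d where d: "sum_cut v ?B d \<or> sum_cut (\<lambda>i. - v i) ?B d"
      using IH by blast
    have "\<not> sum_cut v ?B d"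
    proof
      assume "sum_cut v ?B d"
      then have "sum_cut v A d" and "d < c"
        using lt unfolding sum_cut_def by (auto, meson linorder_not_less less_trans)
      then show False using least by force
    qed
    with d have d: "sum_cut (\<lambda>i. - v i) ?B d" by blast
    obtain e where e: "e \<in> A" "e < d" "e < c" using d unfolding sum_cut_def by auto
    have dA: "d \<in> A" "d < c" using d unfolding sum_cut_def by auto
    have gt': "\<And>i j. i \<in> A \<Longrightarrow> j \<in> A \<Longrightarrow> i < d \<Longrightarrow> d \<le> j \<Longrightarrow> j < c \<Longrightarrow> v j < v i"
      using d unfolding sum_cut_def by fastforce
    \<comment> \<open>The skew cut \<open>d\<close> puts all larger values of the first block before
      \<open>d\<close>. Hence some \<open>p\<close> before \<open>d\<close> exceeds
      \<open>v m\<close>, some \<open>q\<close> from \<open>d\<close> on is below it, and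
      \<open>p, q, c, m\<close> is an occurrence of 3142.\<close>
    obtain p where p: "p \<in> A" "p < d" "v m < v p"
      using e mid gt'[of e \<alpha>] by (cases "\<alpha> < d") force+
    obtain q where q: "q \<in> A" "d \<le> q" "q < c" "v q < v m"
      using dA mid gt'[of \<beta> d] \<open>\<beta> < c\<close> by (cases "\<beta> < d") force+
    have "pattern_3142 v (insert m A)"
      unfolding pattern_3142_def
      using p q cA dA gt[OF cA] lt[of p c]
      by (intro bexI[of _ p] bexI[of _ q] bexI[of _ c] bexI[of _ m]) auto
    then show ?thesis using no by blast
  qed
qed

text \<open>Induction by deleting the last position. A skew cut of the remaining set is handled by
  \<open>sum_cut_insert_max\<close> for \<open>- v\<close>, where the roles of 3142 and 2413 are
  exchanged.\<close>

lemma separable_on_imp_cut: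
  fixes v :: "nat \<Rightarrow> int"
  assumes "finite A" "2 \<le> card A" "inj_on v A" "separable_on A v"
  shows "\<exists>c. sum_cut v A c \<or> sum_cut (\<lambda>i. - v i) A c"
  using assms
proof (induction A rule: finite_psubset_induct)
  case (psubset A)
  define m where "m = Max A"
  define B where "B = A - {m}"
  have "A \<noteq> {}" using psubset.prems by auto
  then have mA: "m \<in> A" and A: "A = insert m B"
    using Max_in[OF psubset.hyps(1)] by (auto simp: m_def B_def)
  have gt: "i < m" if "i \<in> B" for i
    using that psubset.hyps by (auto simp: m_def B_def order_less_le)
  have ne: "v i \<noteq> v m" if "i \<in> B" for i
    using that psubset.prems(2) mA by (auto simp: B_def inj_on_def)
  have "B \<subset> A" using mA by (auto simp: B_def)
  have finB: "finite B" using psubset.hyps by (simp add: B_def)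
  have IH: "\<exists>c. sum_cut v C c \<or> sum_cut (\<lambda>i. - v i) C c" if "C \<subseteq> B" "2 \<le> card C" for C
    using psubset.IH[of C] psubset.prems that \<open>B \<subset> A\<close>
    by (meson inj_on_subset order_trans psubset_imp_subset separable_on_subset subset_psubset_trans)
  have no: "\<not> pattern_3142 v (insert m B)" "\<not> pattern_3142 (\<lambda>i. - v i) (insert m B)"
    using psubset.prems(3) A by (auto simp: separable_on_def pattern_uminus)
  show ?case
  proof (cases "2 \<le> card B")
    case True
    then obtain c where "sum_cut v B c \<or> sum_cut (\<lambda>i. - v i) B c" using IH by blast
    then show ?thesis
    proof
      assume "sum_cut v B c"
      then show ?thesis
        unfolding A using sum_cut_insert_max[OF _ finB gt ne no(1) IH] by blast
    next
      assume "sum_cut (\<lambda>i. - v i) B c"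
      moreover have "- v i \<noteq> - v m" if "i \<in> B" for i using ne[OF that] by simp
      moreover have "\<exists>c. sum_cut (\<lambda>i. - v i) C c \<or> sum_cut (\<lambda>i. - (- v i)) C c"
        if "C \<subseteq> B" "2 \<le> card C" for C using IH[OF that] by auto
      ultimately have "\<exists>c. sum_cut (\<lambda>i. - v i) (insert m B) c
          \<or> sum_cut (\<lambda>i. - (- v i)) (insert m B) c"
        using sum_cut_insert_max[OF _ finB gt _ no(2)] by blast
      then show ?thesis unfolding A by auto
    qed
  next
    case False
    have "card A = Suc (card B)" using card_Suc_Diff1[OF psubset.hyps(1) mA] by (simp add: B_def)
    with False psubset.prems(1) have "card B = 1" by auto
    then obtain i where "B = {i}" by (auto simp: card_1_singleton_iff)
    then have "sum_cut v A m \<or> sum_cut (\<lambda>i. - v i) A m"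
      using gt ne by (fastforce simp: A sum_cut_def)
    then show ?thesis by blast
  qed
qed

section \<open>Rigidity of factorizations over a separable permutation\<close>

lemma cut_invariant:
  assumes "finite A" "bij_betw \<sigma> A A"
    and f: "\<And>i. i \<in> A \<Longrightarrow> f i = f' (\<sigma> i)"
    and lt: "\<And>i j. i \<in> A \<Longrightarrow> j \<in> A \<Longrightarrow> i < c \<Longrightarrow> c \<le> j \<Longrightarrow> f i < f j \<and> f' i < (f' j :: nat)"
  shows "bij_betw \<sigma> {i\<in>A. i < (c::nat)} {i\<in>A. i < c}" "bij_betw \<sigma> {i\<in>A. c \<le> i} {i\<in>A. c \<le> i}"
proof -
  let ?L = "{i\<in>A. i < c}" and ?U = "{i\<in>A. c \<le> i}"
  have inj: "inj_on \<sigma> A" and im: "\<sigma> ` A = A" using assms(2) by (auto simp: bij_betw_def)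
  have "\<sigma> ` ?L \<subseteq> ?L"
  proof (rule ccontr)
    assume "\<not> \<sigma> ` ?L \<subseteq> ?L"
    then obtain i where i: "i \<in> A" "i < c" "\<sigma> i \<in> A" "c \<le> \<sigma> i" using im by force
    \<comment> \<open>By counting, if some \<open>i\<close> crosses \<open>c\<close> upwards then
      some \<open>j\<close> crosses it downwards. Then \<open>f i < f j\<close>, while comparing
      \<open>f'\<close> at the images gives the opposite inequality.\<close>
    have "\<not> \<sigma> ` ?U \<subseteq> ?U"
    proof
      assume "\<sigma> ` ?U \<subseteq> ?U"
      then have "\<sigma> ` ?U = ?U"
        using assms(1) inj by (intro endo_inj_surj) (auto intro: inj_on_subset)
      then obtain j where "j \<in> ?U" "\<sigma> j = \<sigma> i" using i by (metis (mono_tags, lifting) imageE mem_Collect_eq)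
      then show False using inj i by (auto simp: inj_on_def)
    qed
    then obtain j where j: "j \<in> A" "c \<le> j" "\<sigma> j \<in> A" "\<sigma> j < c" using im by force
    show False using lt[of i j] lt[of "\<sigma> j" "\<sigma> i"] i j f by auto
  qed
  then have L: "\<sigma> ` ?L = ?L"
    using assms(1) inj by (intro endo_inj_surj) (auto intro: inj_on_subset)
  then show "bij_betw \<sigma> ?L ?L" using inj by (auto simp: bij_betw_def intro: inj_on_subset)
  have "?U = A - ?L" by auto
  then have "\<sigma> ` ?U = ?U" using inj im L by (simp add: inj_on_image_set_diff[of \<sigma> A])
  then show "bij_betw \<sigma> ?U ?U" using inj by (auto simp: bij_betw_def intro: inj_on_subset)
qed

text \<open>
  Taking \<open>v = inv u\<close>, \<open>f = inv y\<close> and \<open>g = x\<close>, the monotonicity assumptions say that \<open>y\<close> and \<open>x\<close>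
  lie in the upper bounds for \<open>Y\<close> and \<open>X\<close>; an equality \<open>x \<circ> y = x' \<circ> y'\<close> yields
  \<open>\<sigma> = y' \<circ> inv y = inv x' \<circ> x\<close>.
\<close>

lemma separable_rigid:
  fixes v :: "nat \<Rightarrow> int" and f f' g g' :: "nat \<Rightarrow> nat"
  assumes "finite A" "inj_on v A" "separable_on A v" "bij_betw \<sigma> A A"
    and "\<And>i. i \<in> A \<Longrightarrow> f i = f' (\<sigma> i)" "\<And>i. i \<in> A \<Longrightarrow> g i = g' (\<sigma> i)"
    and "\<And>i j. i \<in> A \<Longrightarrow> j \<in> A \<Longrightarrow> i < j \<Longrightarrow> v i < v j \<Longrightarrow> f i < f j \<and> f' i < f' j"
    and "\<And>i j. i \<in> A \<Longrightarrow> j \<in> A \<Longrightarrow> i < j \<Longrightarrow> v j < v i \<Longrightarrow> g i < g j \<and> g' i < g' j"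
    and "i \<in> A"
  shows "\<sigma> i = i"
  using assms
proof (induction A arbitrary: i rule: finite_psubset_induct)
  case (psubset A)
  show ?case
  proof (cases "2 \<le> card A")
    case True
    then obtain c where c: "sum_cut v A c \<or> sum_cut (\<lambda>i. - v i) A c"
      using separable_on_imp_cut[OF psubset.hyps(1)] psubset.prems(1,2) by blast
    \<comment> \<open>Across a direct cut \<open>f\<close> and \<open>f'\<close> are increasing,
      across a skew cut \<open>g\<close> and \<open>g'\<close> are. Either way
      \<open>\<sigma>\<close> preserves both blocks, to which induction applies.\<close>
    have "bij_betw \<sigma> {i\<in>A. i < c} {i\<in>A. i < c} \<and> bij_betw \<sigma> {i\<in>A. c \<le> i} {i\<in>A. c \<le> i}"
      using c
    proof
      assume "sum_cut v A c"
      then have "f i < f j \<and> f' i < f' j" if "i \<in> A" "j \<in> A" "i < c" "c \<le> j" for i j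
        using that psubset.prems(6)[of i j] by (auto simp: sum_cut_def)
      then show ?thesis
        using cut_invariant[OF psubset.hyps(1) psubset.prems(3), of f f' c] psubset.prems(4) by blast
    next
      assume "sum_cut (\<lambda>i. - v i) A c"
      then have "g i < g j \<and> g' i < g' j" if "i \<in> A" "j \<in> A" "i < c" "c \<le> j" for i j
        using that psubset.prems(7)[of i j] by (auto simp: sum_cut_def)
      then show ?thesis
        using cut_invariant[OF psubset.hyps(1) psubset.prems(3), of g g' c] psubset.prems(5) by blast
    qed
    moreover have "{i\<in>A. i < c} \<subset> A" "{i\<in>A. c \<le> i} \<subset> A"
      using c by (auto simp: sum_cut_def)
    moreover have "\<sigma> i = i" if "B \<subset> A" "bij_betw \<sigma> B B" "i \<in> B" for B
    proof -
      have sub: "\<And>k. k \<in> B \<Longrightarrow> k \<in> A" using that(1) by blast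
      show ?thesis
        by (rule psubset.IH[OF that(1) inj_on_subset separable_on_subset that(2)])
          (use that sub psubset.prems in blast)+
    qed
    ultimately show ?thesis
      using psubset.prems(8) by (cases "i < c") auto
  next
    case False
    then have "A = {i}"
      using psubset.prems(8) psubset.hyps
      by (metis One_nat_def Suc_1 card_le_Suc0_iff_eq is_singletonI' is_singleton_the_elem not_less_eq_eq singletonD empty_iff)
    then show ?thesis using psubset.prems(3) by (auto simp: bij_betw_def)
  qed
qed

section \<open>Reduced products and inversions\<close>

definition reduced :: "nat set \<Rightarrow> (nat \<Rightarrow> nat) \<Rightarrow> (nat \<Rightarrow> nat) \<Rightarrow> bool" where
  "reduced A x y \<longleftrightarrow> (\<forall>i\<in>A. \<forall>j\<in>A. i < j \<longrightarrow> \<not> (x j < x i \<and> inv y j < inv y i))"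

text \<open>This is the right weak order as containment of inversion sets of the inverses;
  \<open>right_interval_eq\<close> gives the link to lengths.\<close>

definition weak_le :: "nat set \<Rightarrow> (nat \<Rightarrow> nat) \<Rightarrow> (nat \<Rightarrow> nat) \<Rightarrow> bool" where
  "weak_le A y u \<longleftrightarrow> (\<forall>i\<in>A. \<forall>j\<in>A. i < j \<longrightarrow> inv y j < inv y i \<longrightarrow> inv u j < inv u i)"

definition inversions :: "nat \<Rightarrow> (nat \<Rightarrow> nat) \<Rightarrow> (nat \<times> nat) set" where
  "inversions n w = {(i, j). i \<in> {1..n} \<and> j \<in> {1..n} \<and> i < j \<and> w i > w j}"

lemma finite_inversions: "finite (inversions n w)"
  by (rule finite_subset[of _ "{1..n} \<times> {1..n}"]) (auto simp: inversions_def)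

text \<open>Moving a pair of positions through \<open>y\<close> and sorting it is a bijection. The
  product inverts the original pair iff exactly one of \<open>x\<close> and \<open>inv y\<close>
  inverts the moved one.\<close>

lemma card_inversions_comp:
  assumes x: "x permutes {1..n}" and y: "y permutes {1..n}"
  shows "card (inversions n (x \<circ> y)) =
    card (sym_diff (inversions n x) (inversions n (inv y)))"
proof -
  let ?A = "{1..n}"
  define \<phi> where "\<phi> z = (\<lambda>(i, j). (min (z i) (z j), max (z i) (z j)))" for z :: "nat \<Rightarrow> nat"
  have inA: "y i \<in> ?A" "inv y i \<in> ?A" if "i \<in> ?A" for i
    using that permutes_in_image[OF y] permutes_in_image[OF permutes_inv[OF y]] by auto
  have injx: "x i = x j \<longleftrightarrow> i = j" for i j
    using permutes_inj[OF x] by (simp add: inj_eq)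
  have invy: "inv y (y i) = i" "y (inv y i) = i" for i using permutes_inverses[OF y] by auto
  have injiy: "inv y i = inv y j \<longleftrightarrow> i = j" for i j using invy by metis
  have "bij_betw (\<phi> y) (inversions n (x \<circ> y))
      (sym_diff (inversions n x) (inversions n (inv y)))"
  proof (rule bij_betw_byWitness[where f' = "\<phi> (inv y)"])
    have \<phi>: "\<phi> (inv z) (\<phi> z (i, j)) = (i, j)" if "i < j" "z permutes ?A" for z i j
      using that by (simp add: \<phi>_def min_def max_def permutes_inverses)
    show "\<forall>p\<in>inversions n (x \<circ> y). \<phi> (inv y) (\<phi> y p) = p"
      using \<phi>[OF _ y] by (auto simp: inversions_def)
    show "\<forall>p\<in>sym_diff (inversions n x) (inversions n (inv y)). \<phi> y (\<phi> (inv y) p) = p"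
      using \<phi>[OF _ permutes_inv[OF y]] permutes_inv_inv[OF y] by (auto simp: inversions_def)
    show "\<phi> y ` inversions n (x \<circ> y) \<subseteq> sym_diff (inversions n x) (inversions n (inv y))"
    proof (rule image_subsetI)
      fix p assume "p \<in> inversions n (x \<circ> y)"
      then obtain i j where p: "p = (i, j)" and *: "i \<in> ?A" "j \<in> ?A" "i < j" "x (y j) < x (y i)" by (auto simp: inversions_def)
      then have "y i \<noteq> y j" by auto
      then show "\<phi> y p \<in> sym_diff (inversions n x) (inversions n (inv y))"
        using * inA(1)[OF *(1)] inA(1)[OF *(2)]
        by (cases "y i < y j") (simp_all add: p inversions_def \<phi>_def invy)
    qed
    show "\<phi> (inv y) ` (sym_diff (inversions n x) (inversions n (inv y))) \<subseteq> inversions n (x \<circ> y)"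
    proof (rule image_subsetI)
      fix p assume "p \<in> sym_diff (inversions n x) (inversions n (inv y))"
      then obtain i j where p: "p = (i, j)" and *: "i \<in> ?A" "j \<in> ?A" "i < j" "(x j < x i) \<noteq> (inv y j < inv y i)"
        by (auto simp: inversions_def)
      have "x i \<noteq> x j" "inv y i \<noteq> inv y j" using * injx injiy by auto
      then show "\<phi> (inv y) p \<in> inversions n (x \<circ> y)"
        using * inA(2)[OF *(1)] inA(2)[OF *(2)]
        by (cases "inv y i < inv y j") (simp_all add: p inversions_def \<phi>_def invy)
    qed
  qed
  then show ?thesis by (rule bij_betw_same_card)
qed

text \<open>The symmetric difference of two finite sets has the sum of their cardinalities exactly
  when they are disjoint.\<close>

lemma len_comp_iff_reduced:
  assumes "x permutes {1..n}" "y permutes {1..n}"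
  shows "len n (x \<circ> y) = len n x + len n y \<longleftrightarrow> reduced {1..n} x y"
proof -
  let ?I = "inversions n x" and ?J = "inversions n (inv y)"
  have len: "len n w = card (inversions n w)" for w by (simp add: len_def inversions_def)
  have "inversions n id = {}" by (auto simp: inversions_def)
  then have "len n y = card ?J"
    using card_inversions_comp[OF permutes_id assms(2)] len by simp
  moreover have "card (sym_diff ?I ?J) + 2 * card (?I \<inter> ?J) = card ?I + card ?J"
  proof -
    have "card (sym_diff ?I ?J) = card (?I - ?J) + card (?J - ?I)"
      by (intro card_Un_disjoint) (auto simp: finite_inversions)
    moreover have "card ?I = card (?I - ?J) + card (?I \<inter> ?J)"
      using card_Int_Diff[OF finite_inversions, of n x ?J] by simp
    moreover have "card ?J = card (?J - ?I) + card (?I \<inter> ?J)"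
      using card_Int_Diff[OF finite_inversions, of n "inv y" ?I] by (simp add: Int_commute)
    ultimately show ?thesis by simp
  qed
  ultimately have "len n (x \<circ> y) = len n x + len n y \<longleftrightarrow> card (?I \<inter> ?J) = 0"
    using card_inversions_comp[OF assms] len by force
  also have "\<dots> \<longleftrightarrow> ?I \<inter> ?J = {}" by (simp add: finite_inversions)
  also have "\<dots> \<longleftrightarrow> reduced {1..n} x y" unfolding inversions_def reduced_def by blast
  finally show ?thesis .
qed

text \<open>A pair inverted by both \<open>y\<close> and \<open>inv u \<circ> y\<close>, moved
  forward by \<open>y\<close>, is a pair inverted by \<open>inv y\<close> but not by
  \<open>inv u\<close>.\<close>

lemma reduced_inv_comp_iff:
  assumes y: "y permutes A" and u: "u permutes A"
  shows "reduced A y (inv y \<circ> u) \<longleftrightarrow> weak_le A y u"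
proof -
  have inv: "inv (inv y \<circ> u) = inv u \<circ> y"
    using y u by (simp add: o_inv_distrib permutes_bij bij_imp_bij_inv inv_inv_eq)
  have invy: "inv y (y i) = i" "y (inv y i) = i" for i using permutes_inverses[OF y] by auto
  have inA: "y i \<in> A" "inv y i \<in> A" if "i \<in> A" for i
    using that permutes_in_image[OF y] permutes_in_image[OF permutes_inv[OF y]] by auto
  have ne: "inv u i \<noteq> inv u j" if "i \<noteq> j" for i j
    using that permutes_inverses[OF u] by metis
  show ?thesis
  proof
    assume *: "reduced A y (inv y \<circ> u)"
    show "weak_le A y u"
      unfolding weak_le_def
    proof (intro ballI impI)
      fix i j assume ij: "i \<in> A" "j \<in> A" "i < j" "inv y j < inv y i"
      then have "\<not> inv u i < inv u j"
        using *[unfolded reduced_def inv, rule_format, of "inv y j" "inv y i"] inA by (simp add: invy)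
      then show "inv u j < inv u i" using ne[of i j] ij by auto
    qed
  next
    assume *: "weak_le A y u"
    show "reduced A y (inv y \<circ> u)"
      unfolding reduced_def inv comp_apply
    proof (intro ballI impI notI, elim conjE)
      fix i j assume ij: "i \<in> A" "j \<in> A" "i < j" "y j < y i" "inv u (y j) < inv u (y i)"
      then show False
        using * inA(1) unfolding weak_le_def by (metis invy(1) order_less_asym)
    qed
  qed
qed

lemma right_interval_eq:
  assumes "u \<in> Sym n"
  shows "right_interval n u = {y. y permutes {1..n} \<and> weak_le {1..n} y u}"
proof -
  have u: "u permutes {1..n}" using assms by (simp add: Sym_def)
  have "right_le n y u \<longleftrightarrow> weak_le {1..n} y u" if y: "y permutes {1..n}" for y
  proof -
    have "right_le n y u \<longleftrightarrow>
        (\<exists>z. z permutes {1..n} \<and> u = y \<circ> z \<and> len n (y \<circ> z) = len n y + len n z)"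
      using y u by (auto simp: right_le_def Sym_def)
    also have "\<dots> \<longleftrightarrow> (\<exists>z. z permutes {1..n} \<and> u = y \<circ> z \<and> reduced {1..n} y z)"
      using len_comp_iff_reduced[OF y] by blast
    also have "\<dots> \<longleftrightarrow> reduced {1..n} y (inv y \<circ> u)"
    proof
      assume "\<exists>z. z permutes {1..n} \<and> u = y \<circ> z \<and> reduced {1..n} y z"
      then show "reduced {1..n} y (inv y \<circ> u)"
        using permutes_inv_o(2)[OF y] by (auto simp: o_assoc)
    next
      assume "reduced {1..n} y (inv y \<circ> u)"
      moreover have "(inv y \<circ> u) permutes {1..n}"
        using y u by (simp add: permutes_compose permutes_inv)
      moreover have "u = y \<circ> (inv y \<circ> u)" using permutes_inv_o(1)[OF y] by (simp add: o_assoc)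
      ultimately show "\<exists>z. z permutes {1..n} \<and> u = y \<circ> z \<and> reduced {1..n} y z" by blast
    qed
    also have "\<dots> \<longleftrightarrow> weak_le {1..n} y u" by (rule reduced_inv_comp_iff[OF y u])
    finally show ?thesis .
  qed
  then show ?thesis by (auto simp: right_interval_def right_le_def Sym_def)
qed

lemma weak_leD:
  assumes "weak_le A y u" "y permutes A" "i \<in> A" "j \<in> A" "i < j" "inv u i < inv u j"
  shows "inv y i < inv y j"
proof -
  have "inv y i \<noteq> inv y j" using assms(5) permutes_inverses(1)[OF assms(2)] by (metis less_irrefl)
  moreover have "\<not> inv y j < inv y i" using assms unfolding weak_le_def by (metis less_asym)
  ultimately show ?thesis by simp
qed

lemma reducedD:
  assumes "reduced A x u" "x permutes A" "i \<in> A" "j \<in> A" "i < j" "inv u j < inv u i"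
  shows "x i < x j"
proof -
  have "x i \<noteq> x j" using assms(5) permutes_inverses(2)[OF assms(2)] by (metis less_irrefl)
  moreover have "\<not> x j < x i" using assms unfolding reduced_def by blast
  ultimately show ?thesis by simp
qed

section \<open>Splittings of the symmetric group on an interval\<close>

text \<open>The longest element of the symmetric group on \<open>{a..b}\<close>.\<close>

definition flip :: "nat \<Rightarrow> nat \<Rightarrow> nat \<Rightarrow> nat" where
  "flip a b i = (if i \<in> {a..b} then a + b - i else i)"

lemma flip_flip: "flip a b (flip a b i) = i"
  by (auto simp: flip_def)

lemma flip_comp_flip: "flip a b \<circ> flip a b = id"
  by (auto simp: flip_flip)

lemma flip_permutes: "flip a b permutes {a..b}"
proof (rule bij_imp_permutes)
  show "bij_betw (flip a b) {a..b} {a..b}"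
    by (rule bij_betw_byWitness[where f' = "flip a b"]) (auto simp: flip_flip, auto simp: flip_def)
qed (auto simp: flip_def)

lemma flip_less_iff: "i \<in> {a..b} \<Longrightarrow> j \<in> {a..b} \<Longrightarrow> flip a b i < flip a b j \<longleftrightarrow> j < i"
  by (auto simp: flip_def)

text \<open>General intervals make the notion stable under restriction to the subgroup fixing an end
  point. Additivity of lengths appears as \<open>reduced\<close>, which does not depend on a length
  function.\<close>

locale interval_splitting =
  fixes a b :: nat and X Y :: "(nat \<Rightarrow> nat) set"
  assumes X_perm: "x \<in> X \<Longrightarrow> x permutes {a..b}"
    and Y_perm: "y \<in> Y \<Longrightarrow> y permutes {a..b}"
    and factor: "w permutes {a..b} \<Longrightarrow> \<exists>x\<in>X. \<exists>y\<in>Y. w = x \<circ> y"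
    and unique: "\<lbrakk>x \<in> X; x' \<in> X; y \<in> Y; y' \<in> Y; x \<circ> y = x' \<circ> y'\<rbrakk> \<Longrightarrow> x = x' \<and> y = y'"
    and red: "x \<in> X \<Longrightarrow> y \<in> Y \<Longrightarrow> reduced {a..b} x y"

locale top_splitting = interval_splitting +
  fixes u
  assumes u_in: "u \<in> Y" and flip_in: "flip a b \<circ> inv u \<in> X"

context interval_splitting
begin

lemma exists_top: "\<exists>u. top_splitting a b X Y u"
proof -
  obtain x y where xy: "x \<in> X" "y \<in> Y" "flip a b = x \<circ> y"
    using factor[OF flip_permutes] by blast
  then have "flip a b \<circ> inv y = x"
    using permutes_inv_o(1)[OF Y_perm[OF xy(2)]] by (simp add: comp_assoc)
  then show ?thesis
    using xy by (intro exI[of _ y] top_splitting.intro top_splitting_axioms.intro) (unfold_locales, auto)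
qed

lemma id_mem: "id \<in> X" "id \<in> Y"
proof -
  obtain x y where xy: "x \<in> X" "y \<in> Y" "id = x \<circ> y"
    using factor[OF permutes_id] by blast
  have x: "x permutes {a..b}" using xy X_perm by blast
  have y: "y = inv x" using xy(3) permutes_inv_o(2)[OF x] by (metis comp_assoc comp_id id_comp)
  then have "inv y = x" using permutes_inv_inv[OF x] by simp
  then have mono: "x i < x j" if "i \<in> {a..b}" "j \<in> {a..b}" "i < j" for i j
    using red[OF xy(1,2)] that permutes_inj[OF x] unfolding reduced_def
    by (metis injD linorder_neqE_nat order_less_irrefl)
  have sep: "separable_on {a..b} int"
    unfolding separable_on_def pattern_2413_def pattern_3142_def by auto
  \<comment> \<open>An increasing bijection is the identity; this is the instance of rigidity with
    \<open>\<sigma> = x\<close> and the separable sequence \<open>int\<close>.\<close>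
  have "x i = i" if "i \<in> {a..b}" for i
    by (rule separable_rigid[OF _ _ sep permutes_imp_bij[OF x], of x id x id])
      (use that mono in auto)
  then have "x = id" using permutes_not_in[OF x] by (metis eq_id_iff)
  then show "id \<in> X" "id \<in> Y" using xy y by auto
qed

text \<open>If \<open>w\<close> fixes the end point \<open>m\<close>, then so do its factors:
  otherwise the pair formed by \<open>m\<close> and \<open>y m\<close> would be inverted by both
  \<open>x\<close> and \<open>inv y\<close>.\<close>

lemma restrict:
  assumes B: "{c..d} = {a..b} - {m}" and m: "m \<in> {a..b}" "m = a \<or> m = b"
  shows "interval_splitting c d {x \<in> X. x permutes {c..d}} {y \<in> Y. y permutes {c..d}}"
proof
  fix w assume w: "w permutes {c..d}"
  then have "w permutes {a..b}" by (rule permutes_subset) (use B in blast)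
  then obtain x y where xy: "x \<in> X" "y \<in> Y" "w = x \<circ> y" using factor by blast
  have x: "x permutes {a..b}" and y: "y permutes {a..b}" using xy X_perm Y_perm by auto
  have xym: "x (y m) = m" using permutes_not_in[OF w, of m] B xy(3) by auto
  have ym_in: "y m \<in> {a..b}" "inv y m \<in> {a..b}" "x m \<in> {a..b}"
    using permutes_in_image[OF y] permutes_in_image[OF permutes_inv[OF y]]
      permutes_in_image[OF x] m(1) by blast+
  have inv: "inv y (y m) = m" using permutes_inverses(2)[OF y] by simp
  have "y m = m"
  proof (rule ccontr)
    assume ne: "y m \<noteq> m"
    then have ne': "inv y m \<noteq> m" "x m \<noteq> m"
      using permutes_inverses(1)[OF y, of m] permutes_inj[OF x] xym by (metis, metis injD)
    show False
    proof (cases "m = a")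
      case True
      then have "m < y m" "m < inv y m" "m < x m" using ym_in ne ne' by auto
      then show False
        using red[OF xy(1,2)] m(1) ym_in xym inv unfolding reduced_def by (metis)
    next
      case False
      then have "y m < m" "inv y m < m" "x m < m" using m(2) ym_in ne ne' by auto
      then show False
        using red[OF xy(1,2)] m(1) ym_in xym inv unfolding reduced_def by (metis)
    qed
  qed
  then have "x permutes {c..d}" "y permutes {c..d}"
    using xym B by (auto intro!: permutes_superset[OF x] permutes_superset[OF y])
  then show "\<exists>x\<in>{x \<in> X. x permutes {c..d}}. \<exists>y\<in>{y \<in> Y. y permutes {c..d}}. w = x \<circ> y"
    using xy by blast
next
  fix x y assume "x \<in> {x \<in> X. x permutes {c..d}}" "y \<in> {y \<in> Y. y permutes {c..d}}"
  then show "reduced {c..d} x y" using red B unfolding reduced_def by blast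
qed (use unique in blast)+

end

section \<open>Upper bounds for the two factors, and symmetries of splittings\<close>

context top_splitting
begin

lemma u_perm: "u permutes {a..b}"
  using Y_perm u_in by blast

lemma inv_u_in: "i \<in> {a..b} \<Longrightarrow> inv u i \<in> {a..b}"
  using permutes_in_image[OF permutes_inv[OF u_perm]] by blast

lemma inv_u_eq_iff: "inv u i = inv u j \<longleftrightarrow> i = j"
  using permutes_inverses(1)[OF u_perm] by metis

text \<open>The element \<open>flip a b \<circ> inv u\<close> of \<open>X\<close> inverts exactly
  the pairs that \<open>inv u\<close> does not, so its product with \<open>y\<close> being reduced
  is a containment of inversions.\<close>

lemma Y_weak_le:
  assumes "y \<in> Y"
  shows "weak_le {a..b} y u"
  unfolding weak_le_def
proof (intro ballI impI)
  fix i j assume ij: "i \<in> {a..b}" "j \<in> {a..b}" "i < j" "inv y j < inv y i"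
  then have "\<not> flip a b (inv u j) < flip a b (inv u i)"
    using red[OF flip_in assms] unfolding reduced_def by auto
  then show "inv u j < inv u i"
    using flip_less_iff[OF inv_u_in inv_u_in, of j i] ij inv_u_eq_iff[of i j] by auto
qed

text \<open>The factors of \<open>x \<circ> y\<close> in \<open>X\<close> and \<open>Y\<close>
  satisfy the same bounds as \<open>x\<close> and \<open>y\<close>, so rigidity identifies the two
  factorizations.\<close>

lemma mem_if_separable:
  assumes sep: "separable_on {a..b} (inv u)"
    and x: "x permutes {a..b}" "reduced {a..b} x u"
    and y: "y permutes {a..b}" "weak_le {a..b} y u"
  shows "x \<in> X" "y \<in> Y"
proof -
  obtain x' y' where xy: "x' \<in> X" "y' \<in> Y" "x \<circ> y = x' \<circ> y'"
    using factor[OF permutes_compose[OF y(1) x(1)]] by blast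
  have x': "x' permutes {a..b}" and y': "y' permutes {a..b}"
    using xy X_perm Y_perm by auto
  have eq: "x (y i) = x' (y' i)" for i using xy(3) by (metis comp_apply)
  have "(y' \<circ> inv y) i = i" if "i \<in> {a..b}" for i
  proof (rule separable_rigid[where v = "\<lambda>i. int (inv u i)" and f = "inv y" and f' = "inv y'"
        and g = x and g' = x'])
    show "separable_on {a..b} (\<lambda>i. int (inv u i))" using sep by (simp add: separable_on_of_nat)
    show "bij_betw (y' \<circ> inv y) {a..b} {a..b}"
      using permutes_imp_bij[OF permutes_compose[OF permutes_inv[OF y(1)] y']] .
    show "inj_on (\<lambda>i. int (inv u i)) {a..b}" by (auto simp: inj_on_def inv_u_eq_iff)
    show "inv y i = inv y' ((y' \<circ> inv y) i)" for i using permutes_inverses(2)[OF y'] by simp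
    show "x i = x' ((y' \<circ> inv y) i)" for i
      using eq[of "inv y i"] permutes_inverses(1)[OF y(1)] by simp
    fix i j assume ij: "i \<in> {a..b}" "j \<in> {a..b}" "i < j"
    show "inv y i < inv y j \<and> inv y' i < inv y' j" if "int (inv u i) < int (inv u j)"
      using weak_leD[OF y(2,1) ij] weak_leD[OF Y_weak_le[OF xy(2)] y' ij] that by simp
    show "x i < x j \<and> x' i < x' j" if "int (inv u j) < int (inv u i)"
      using reducedD[OF x(2,1) ij] reducedD[OF red[OF xy(1) u_in] x' ij] that by simp
  qed (use that in auto)
  then have "y' \<circ> inv y = id"
    using permutes_not_in[OF permutes_compose[OF permutes_inv[OF y(1)] y']] by (metis eq_id_iff)
  then have "y' = y" using permutes_inv_o(2)[OF y(1)] by (metis comp_assoc comp_id id_comp)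
  moreover from this have "x' = x"
    using xy(3) permutes_inv_o(1)[OF y(1)] by (metis comp_assoc comp_id)
  ultimately show "x \<in> X" "y \<in> Y" using xy by auto
qed

text \<open>The new top is \<open>inv u\<close>, so this symmetry exchanges values and positions:
  what is proved about deleting an end value of \<open>u\<close> becomes available for an end
  position.\<close>

lemma position_splitting:
  "top_splitting a b ((\<lambda>x. flip a b \<circ> x \<circ> u) ` X) ((\<lambda>y. inv u \<circ> y) ` Y) (inv u)"
proof -
  let ?X = "(\<lambda>x. flip a b \<circ> x \<circ> u) ` X" and ?Y = "(\<lambda>y. inv u \<circ> y) ` Y"
  note u = u_perm
  have uu: "u \<circ> inv u = id" "inv u \<circ> u = id" using permutes_inv_o[OF u] by auto
  have comp: "(flip a b \<circ> x \<circ> u) \<circ> (inv u \<circ> y) = flip a b \<circ> (x \<circ> y)"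
    for x and y :: "nat \<Rightarrow> nat"
    using uu by (metis comp_assoc comp_id)
  have "interval_splitting a b ?X ?Y"
  proof
    show "x permutes {a..b}" if "x \<in> ?X" for x
      using that X_perm u flip_permutes by (auto intro!: permutes_compose)
    show "y permutes {a..b}" if "y \<in> ?Y" for y
      using that Y_perm u by (auto intro!: permutes_compose permutes_inv)
    fix w assume "w permutes {a..b}"
    then have "(flip a b \<circ> w) permutes {a..b}" using flip_permutes by (intro permutes_compose)
    then obtain x y where xy: "x \<in> X" "y \<in> Y" "flip a b \<circ> w = x \<circ> y" using factor by blast
    then have "w = (flip a b \<circ> x \<circ> u) \<circ> (inv u \<circ> y)"
      unfolding comp by (metis comp_assoc flip_comp_flip id_comp)
    then show "\<exists>x\<in>?X. \<exists>y\<in>?Y. w = x \<circ> y" using xy by blast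
  next
    fix p p' q q' assume "p \<in> ?X" "p' \<in> ?X" "q \<in> ?Y" "q' \<in> ?Y" and eq: "p \<circ> q = p' \<circ> q'"
    then obtain x x' y y' where *: "x \<in> X" "x' \<in> X" "y \<in> Y" "y' \<in> Y"
        "p = flip a b \<circ> x \<circ> u" "p' = flip a b \<circ> x' \<circ> u" "q = inv u \<circ> y" "q' = inv u \<circ> y'" by blast
    with eq have "flip a b \<circ> (x \<circ> y) = flip a b \<circ> (x' \<circ> y')" unfolding comp[symmetric] by simp
    then have "x \<circ> y = x' \<circ> y'" by (metis comp_assoc flip_comp_flip id_comp)
    then show "p = p' \<and> q = q'" using unique * by blast
  next
    fix p q assume "p \<in> ?X" "q \<in> ?Y"
    then obtain x y where xy: "x \<in> X" "y \<in> Y" "p = flip a b \<circ> x \<circ> u" "q = inv u \<circ> y" by blast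
    have invq: "inv q = inv y \<circ> u"
      using xy(4) Y_perm[OF xy(2)] u
      by (simp add: o_inv_distrib permutes_bij bij_imp_bij_inv inv_inv_eq)
    show "reduced {a..b} p q"
      unfolding reduced_def
    proof (intro ballI impI notI, elim conjE)
      fix i j assume ij: "i \<in> {a..b}" "j \<in> {a..b}" "i < j" "p j < p i" "inv q j < inv q i"
      have uin: "u i \<in> {a..b}" "u j \<in> {a..b}" using ij permutes_in_image[OF u] by blast+
      have xin: "x (u i) \<in> {a..b}" "x (u j) \<in> {a..b}"
        using uin permutes_in_image[OF X_perm[OF xy(1)]] by blast+
      have lt: "x (u i) < x (u j)" using ij(4) flip_less_iff[OF xin(2,1)] by (simp add: xy(3))
      have inv: "inv u (u i) = i" "inv u (u j) = j" using permutes_inverses(2)[OF u] by auto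
      have gt: "inv y (u j) < inv y (u i)" using ij(5) by (simp add: invq)
      show False
      proof (cases "u i < u j")
        case True
        then have "inv u (u j) < inv u (u i)"
          using Y_weak_le[OF xy(2)] uin gt unfolding weak_le_def by blast
        then show False using inv ij by simp
      next
        case False
        then have "u j < u i" using permutes_inj[OF u] ij by (metis injD linorder_neqE_nat less_irrefl)
        then show False
          using red[OF xy(1) u_in] uin lt inv ij(3) unfolding reduced_def by metis
      qed
    qed
  qed
  moreover have "inv u \<in> ?Y" using imageI[OF id_mem(2), of "\<lambda>y. inv u \<circ> y"] by simp
  moreover have "flip a b \<circ> inv (inv u) \<in> ?X"
    using id_mem(1) permutes_inv_inv[OF u] by (auto intro!: image_eqI[of _ _ id])
  ultimately show ?thesis by (intro top_splitting.intro top_splitting_axioms.intro)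
qed

text \<open>The inverse of the new top is \<open>flip a b \<circ> inv u\<close>. Its values are
  those of \<open>inv u\<close> in reversed order, which exchanges 2413 and 3142.\<close>

lemma inverse_splitting: "top_splitting a b (inv ` Y) (inv ` X) (inv (flip a b \<circ> inv u))"
proof -
  have inv_inv: "inv (inv x) = x" if "x \<in> X \<union> Y" for x
    using that X_perm Y_perm permutes_inv_inv by blast
  have comp: "inv y \<circ> inv x = inv (x \<circ> y)" if "x \<in> X" "y \<in> Y" for x y
    using that X_perm Y_perm by (metis o_inv_distrib permutes_bij)
  have "interval_splitting a b (inv ` Y) (inv ` X)"
  proof
    fix w assume w: "w permutes {a..b}"
    then obtain x y where xy: "x \<in> X" "y \<in> Y" "inv w = x \<circ> y"
      using factor permutes_inv by metis
    then have "w = inv y \<circ> inv x" using comp permutes_inv_inv[OF w] by metis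
    then show "\<exists>x\<in>inv ` Y. \<exists>y\<in>inv ` X. w = x \<circ> y" using xy by blast
  next
    fix p p' q q'
    assume "p \<in> inv ` Y" "p' \<in> inv ` Y" "q \<in> inv ` X" "q' \<in> inv ` X" and eq: "p \<circ> q = p' \<circ> q'"
    then obtain x x' y y' where *: "x \<in> X" "x' \<in> X" "y \<in> Y" "y' \<in> Y"
        "p = inv y" "p' = inv y'" "q = inv x" "q' = inv x'" by blast
    then have "inv (x \<circ> y) = inv (x' \<circ> y')" using eq comp by metis
    moreover have "inv (inv (x \<circ> y)) = x \<circ> y" "inv (inv (x' \<circ> y')) = x' \<circ> y'"
      using * X_perm Y_perm by (meson permutes_compose permutes_inv_inv)+
    ultimately have "x \<circ> y = x' \<circ> y'" by metis
    then show "p = p' \<and> q = q'" using unique * by blast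
  next
    fix p q assume "p \<in> inv ` Y" "q \<in> inv ` X"
    then show "reduced {a..b} p q"
      using red inv_inv unfolding reduced_def by fastforce
  qed (use X_perm Y_perm permutes_inv in blast)+
  moreover have "flip a b \<circ> inv (inv (flip a b \<circ> inv u)) \<in> inv ` Y"
  proof -
    have "inv (inv (flip a b \<circ> inv u)) = flip a b \<circ> inv u" using inv_inv flip_in by blast
    moreover have "flip a b \<circ> (flip a b \<circ> inv u) = inv u"
      by (metis comp_assoc flip_comp_flip id_comp)
    ultimately show ?thesis using u_in by simp
  qed
  ultimately show ?thesis
    using flip_in by (intro top_splitting.intro top_splitting_axioms.intro) auto
qed

end

section \<open>Separability of the top element by minimal counterexample\<close>

definition proper_subintervals_separable :: "nat \<Rightarrow> nat \<Rightarrow> bool" where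
  "proper_subintervals_separable a b \<longleftrightarrow> (\<forall>c d X Y u. {c..d} \<subset> {a..b} \<longrightarrow>
     top_splitting c d X Y u \<longrightarrow> separable_on {c..d} (inv u))"

context top_splitting
begin

lemma end_removed:
  assumes IH: "proper_subintervals_separable a b" and m: "m \<in> {a..b}" "m = a \<or> m = b"
  shows "separable_on ({a..b} - {m}) (inv u)"
    and "y permutes ({a..b} - {m}) \<Longrightarrow> weak_le {a..b} y u \<Longrightarrow> y \<in> Y"
proof -
  have "\<exists>c d. {c..d} = {a..b} - {m}"
  proof (cases "m = a")
    case True
    then have "{Suc a..b} = {a..b} - {m}" by auto
    then show ?thesis by blast
  next
    case False
    then have "{a..b - 1} = {a..b} - {m}" using m by auto
    then show ?thesis by blast
  qed
  then obtain c d where B: "{c..d} = {a..b} - {m}" by blast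
  interpret R: interval_splitting c d "{x \<in> X. x permutes {c..d}}" "{y \<in> Y. y permutes {c..d}}"
    by (rule restrict[OF B m])
  obtain u' where "top_splitting c d {x \<in> X. x permutes {c..d}} {y \<in> Y. y permutes {c..d}} u'"
    using R.exists_top by blast
  then interpret R: top_splitting c d "{x \<in> X. x permutes {c..d}}" "{y \<in> Y. y permutes {c..d}}" u' .
  have sub: "{c..d} \<subset> {a..b}" using B m(1) by blast
  \<comment> \<open>Both tops invert the same pairs inside \<open>{c..d}\<close>: one inclusion is
    \<open>Y_weak_le\<close> for \<open>u'\<close> in \<open>Y\<close>, the other is reducedness of
    \<open>flip c d \<circ> inv u'\<close> in \<open>X\<close> against \<open>u\<close>.\<close>
  have lt: "inv u' j < inv u' i \<longleftrightarrow> inv u j < inv u i" if ij: "i \<in> {c..d}" "j \<in> {c..d}" "i < j" for i j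
  proof
    assume "inv u' j < inv u' i"
    then show "inv u j < inv u i"
      using Y_weak_le[of u'] R.u_in ij sub unfolding weak_le_def by blast
  next
    assume gt: "inv u j < inv u i"
    show "inv u' j < inv u' i"
    proof (rule ccontr)
      assume "\<not> inv u' j < inv u' i"
      then have "inv u' i < inv u' j" using R.inv_u_eq_iff[of i j] ij by auto
      then have "flip c d (inv u' j) < flip c d (inv u' i)"
        using flip_less_iff R.inv_u_in ij by blast
      moreover have "flip c d \<circ> inv u' \<in> X" using R.flip_in by blast
      ultimately show False
        using red[OF _ u_in] gt ij sub unfolding reduced_def by (metis comp_apply psubsetD)
    qed
  qed
  have "inv u' i < inv u' j \<longleftrightarrow> inv u i < inv u j" if "i \<in> {c..d}" "j \<in> {c..d}" for i j
    using lt[OF that] lt[OF that(2,1)] R.inv_u_eq_iff[of i j] inv_u_eq_iff[of i j]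
    by (metis linorder_neqE_nat order_less_asym)
  then have cong: "separable_on {c..d} (inv u') \<longleftrightarrow> separable_on {c..d} (inv u)"
    unfolding separable_on_def using pattern_cong[of "{c..d}" "inv u'" "inv u"] by simp
  have sep: "separable_on {c..d} (inv u')"
    using IH sub R.top_splitting_axioms unfolding proper_subintervals_separable_def by blast
  then show "separable_on ({a..b} - {m}) (inv u)" using cong B by simp
  assume y: "y permutes ({a..b} - {m})" "weak_le {a..b} y u"
  have "weak_le {c..d} y u'"
    using y(2) lt sub unfolding weak_le_def by blast
  moreover have "reduced {c..d} id u'" by (auto simp: reduced_def)
  ultimately show "y \<in> Y"
    using R.mem_if_separable(2)[OF sep permutes_id] y(1) B by auto
qed

text \<open>In the position splitting \<open>y\<close> becomes \<open>inv u \<circ> y\<close>, which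
  fixes \<open>a\<close>, so \<open>end_removed\<close> applies. The induction hypothesis covers
  this splitting because it quantifies over all splittings of smaller intervals.\<close>

lemma mem_if_first_eq:
  assumes IH: "proper_subintervals_separable a b" and "a \<le> b"
    and y: "y permutes {a..b}" "weak_le {a..b} y u" "y a = u a"
  shows "y \<in> Y"
proof -
  interpret P: top_splitting a b "(\<lambda>x. flip a b \<circ> x \<circ> u) ` X" "(\<lambda>y. inv u \<circ> y) ` Y" "inv u"
    by (rule position_splitting)
  let ?z = "inv u \<circ> y"
  have z: "?z permutes {a..b}" using y(1) u_perm by (simp add: permutes_compose permutes_inv)
  have "?z a = a" using y(3) permutes_inverses(2)[OF u_perm] by simp
  then have "?z permutes ({a..b} - {a})" by (intro permutes_superset[OF z]) auto
  moreover have "weak_le {a..b} ?z (inv u)"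
    unfolding weak_le_def
  proof (intro ballI impI)
    fix i j assume ij: "i \<in> {a..b}" "j \<in> {a..b}" "i < j" "inv ?z j < inv ?z i"
    have "inv ?z = inv y \<circ> u"
      using y(1) u_perm by (simp add: o_inv_distrib permutes_bij bij_imp_bij_inv inv_inv_eq)
    then have lt: "inv y (u j) < inv y (u i)" using ij by simp
    have uin: "u i \<in> {a..b}" "u j \<in> {a..b}" using ij permutes_in_image[OF u_perm] by blast+
    have "\<not> u i < u j"
      using y(2) lt uin ij(3) permutes_inverses(2)[OF u_perm] unfolding weak_le_def
      by (metis less_asym)
    moreover have "u i \<noteq> u j" using permutes_inj[OF u_perm] ij by (metis injD less_irrefl)
    ultimately show "inv (inv u) j < inv (inv u) i" using permutes_inv_inv[OF u_perm] by simp
  qed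
  ultimately have "?z \<in> (\<lambda>y. inv u \<circ> y) ` Y"
    using P.end_removed(2)[OF IH, of a] \<open>a \<le> b\<close> by simp
  then obtain y' where "y' \<in> Y" "inv u \<circ> y = inv u \<circ> y'" by blast
  moreover from this have "y = y'"
    using permutes_inv_o(1)[OF u_perm] by (metis comp_assoc id_comp)
  ultimately show ?thesis by simp
qed

lemma no_pattern_2413:
  assumes IH: "proper_subintervals_separable a b"
  shows "\<not> pattern_2413 (inv u) {a..b}"
proof
  let ?A = "{a..b}" and ?v = "inv u"
  assume "pattern_2413 ?v ?A"
  then obtain p q r s where pqrs: "p \<in> ?A" "q \<in> ?A" "r \<in> ?A" "s \<in> ?A" "p < q" "q < r" "r < s"
      "?v r < ?v p" "?v p < ?v s" "?v s < ?v q"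
    unfolding pattern_2413_def by blast
  have ab: "a < b" using pqrs by auto
  interpret P: top_splitting a b "(\<lambda>x. flip a b \<circ> x \<circ> u) ` X" "(\<lambda>y. inv u \<circ> y) ` Y" "inv u"
    by (rule position_splitting)
  have uv: "u (?v i) = i" "?v (u i) = i" for i using permutes_inverses[OF u_perm] by auto
  text \<open>Deleting an extreme value or an extreme position destroys every occurrence of 2413.\<close>
  have extreme: "i = a \<and> l = b \<and> ?v k = a \<and> ?v j = b"
    if "i \<in> ?A" "j \<in> ?A" "k \<in> ?A" "l \<in> ?A" "i < j" "j < k" "k < l"
      "?v k < ?v i" "?v i < ?v l" "?v l < ?v j" for i j k l
  proof -
    have end_in: "m \<in> {i, l}" if "m = a \<or> m = b" for m
    proof (rule ccontr)
      assume m: "m \<notin> {i, l}"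
      have "m \<in> ?A" using that ab by auto
      moreover have "m \<noteq> j" "m \<noteq> k"
        using that \<open>i \<in> ?A\<close> \<open>l \<in> ?A\<close> \<open>i < j\<close> \<open>j < k\<close> \<open>k < l\<close> by auto
      ultimately have "\<not> separable_on (?A - {m}) ?v"
        unfolding separable_on_def pattern_2413_def
        using m \<open>i \<in> ?A\<close> \<open>j \<in> ?A\<close> \<open>k \<in> ?A\<close> \<open>l \<in> ?A\<close> \<open>i < j\<close> \<open>j < k\<close> \<open>k < l\<close>
          \<open>?v k < ?v i\<close> \<open>?v i < ?v l\<close> \<open>?v l < ?v j\<close>
        by blast
      then show False using end_removed(1)[OF IH \<open>m \<in> ?A\<close> that] by blast
    qed
    \<comment> \<open>Deleting a value of \<open>inv u\<close> is deleting a position of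
      \<open>u\<close>, where the occurrence of 2413 reads as 3142; hence the position
      splitting.\<close>
    have end_in': "m \<in> {?v k, ?v j}" if "m = a \<or> m = b" for m
    proof (rule ccontr)
      assume m: "m \<notin> {?v k, ?v j}"
      have "m \<in> ?A" using that ab by auto
      note vin = inv_u_in[OF \<open>i \<in> ?A\<close>] inv_u_in[OF \<open>j \<in> ?A\<close>]
        inv_u_in[OF \<open>k \<in> ?A\<close>] inv_u_in[OF \<open>l \<in> ?A\<close>]
      have "m \<noteq> ?v i" "m \<noteq> ?v l"
        using that vin \<open>?v k < ?v i\<close> \<open>?v i < ?v l\<close> \<open>?v l < ?v j\<close> by auto
      then have "?v i \<in> ?A - {m}" "?v j \<in> ?A - {m}" "?v k \<in> ?A - {m}" "?v l \<in> ?A - {m}"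
        using m vin by auto
      moreover have "u (?v i) < u (?v j)" "u (?v j) < u (?v k)" "u (?v k) < u (?v l)"
        using \<open>i < j\<close> \<open>j < k\<close> \<open>k < l\<close> by (simp_all only: uv)
      ultimately have "pattern_3142 u (?A - {m})"
        unfolding pattern_3142_def
        using \<open>?v k < ?v i\<close> \<open>?v i < ?v l\<close> \<open>?v l < ?v j\<close> by blast
      then show False
        using P.end_removed(1)[OF IH \<open>m \<in> ?A\<close> that] permutes_inv_inv[OF u_perm]
        unfolding separable_on_def by simp
    qed
    show ?thesis
      using end_in[of a] end_in[of b] end_in'[of a] end_in'[of b] ab that(5-) by auto
  qed
  note pqrs_eq = extreme[OF pqrs]
  have v_strict: "a < ?v d \<and> ?v d < b" if "d \<in> ?A" "d \<noteq> q" "d \<noteq> r" for d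
    using inv_u_in[OF that(1)] inv_u_eq_iff[of d q] inv_u_eq_iff[of d r] that pqrs_eq
    by (auto simp: order_less_le)
  have v_ne: "?v d \<noteq> ?v a" "?v d \<noteq> ?v b" if "a < d" "d < b" for d
    using inv_u_eq_iff[of d a] inv_u_eq_iff[of d b] that by auto
  have q: "q = a + 1"
  proof (rule ccontr)
    assume "q \<noteq> a + 1"
    \<comment> \<open>If there were a position strictly between \<open>a\<close> and
      \<open>q\<close>, it could replace \<open>a\<close> or \<open>q\<close> in the occurrence,
      according to how its value compares with \<open>?v b\<close>. Either result contradicts
      \<open>extreme\<close>. The argument for \<open>r\<close> is the mirror image.\<close>
    define d where "d = a + 1"
    have d: "a < d" "d < q" "d \<in> ?A" using \<open>q \<noteq> a + 1\<close> pqrs pqrs_eq by (auto simp: d_def)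
    then have vd: "a < ?v d" "?v d < b" using v_strict[of d] pqrs by auto
    consider "?v d < ?v b" | "?v b < ?v d" using v_ne[of d] d pqrs by fastforce
    then show False
    proof cases
      case 1
      then show False using extreme[of d q r b] d vd pqrs pqrs_eq by auto
    next
      case 2
      then show False using extreme[of a d r b] d vd pqrs pqrs_eq by auto
    qed
  qed
  have r: "r = b - 1"
  proof (rule ccontr)
    assume "r \<noteq> b - 1"
    define d where "d = b - 1"
    have d: "r < d" "d < b" "d \<in> ?A" using \<open>r \<noteq> b - 1\<close> pqrs pqrs_eq by (auto simp: d_def)
    then have vd: "a < ?v d" "?v d < b" using v_strict[of d] pqrs by auto
    consider "?v d < ?v a" | "?v a < ?v d" using v_ne[of d] d pqrs by fastforce
    then show False
    proof cases
      case 1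
      then show False using extreme[of a q d b] d vd pqrs pqrs_eq by auto
    next
      case 2
      then show False using extreme[of a q r d] d vd pqrs pqrs_eq by auto
    qed
  qed
  have between: "?v a < ?v d \<and> ?v d < ?v b" if "q < d" "d < r" for d
  proof -
    have d: "d \<in> ?A" "a < d" "d < b" using that pqrs pqrs_eq by auto
    then have vd: "a < ?v d" "?v d < b" using v_strict[of d] that by auto
    have "\<not> ?v d < ?v a" using extreme[of a q d b] that d vd pqrs pqrs_eq by auto
    moreover have "\<not> ?v b < ?v d" using extreme[of a d r b] that d vd pqrs pqrs_eq by auto
    ultimately show ?thesis using v_ne[OF d(2,3)] by auto
  qed
  have ends: "q < r" "a < q" "r < b" "?v r = a" "?v q = b" "?v a < ?v b" "b = r + 1"
    using pqrs pqrs_eq r by auto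
  \<comment> \<open>This is the 4-cycle taking \<open>a\<close> to \<open>r\<close>,
    \<open>r\<close> to \<open>b\<close>, \<open>b\<close> to \<open>q\<close> and \<open>q\<close>
    to \<open>a\<close>. It agrees with \<open>u\<close> at \<open>a\<close>, and \<open>t'\<close>
    is its inverse.\<close>
  define t where "t i = (if i = a then r else if i = q then a else if i = r then b
    else if i = b then q else i)" for i
  define t' where "t' i = (if i = r then a else if i = a then q else if i = b then r
    else if i = q then b else i)" for i
  have tt': "t (t' i) = i" "t' (t i) = i" for i using ends by (auto simp: t_def t'_def)
  have t: "t permutes ?A"
  proof (rule bij_imp_permutes)
    show "bij_betw t ?A ?A"
      by (rule bij_betw_byWitness[where f' = t'])
        (use tt' pqrs ab in \<open>auto simp: t_def t'_def\<close>)
  qed (use pqrs ab in \<open>auto simp: t_def\<close>)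
  have inv_t: "inv t = t'" using tt' by (intro inv_unique_comp) auto
  have "t \<in> Y"
  proof (rule mem_if_first_eq[OF IH])
    show "weak_le ?A t u"
      unfolding weak_le_def inv_t
    proof (intro ballI impI)
      fix i j assume ij: "i \<in> ?A" "j \<in> ?A" "i < j" "t' j < t' i"
      \<comment> \<open>In one-line form \<open>t'\<close> has its least value at \<open>r\<close>
        and its greatest at \<open>q\<close>, and no inversion avoids both. The same extremes are
        taken by \<open>?v\<close> there.\<close>
      then have "j = r \<or> i = q"
        using ends q by (auto simp: t'_def split: if_splits)
      moreover have "i \<noteq> r" if "j = r" using ij that by auto
      ultimately show "?v j < ?v i"
        using v_strict[of i] v_strict[of j] ij ends by fastforce
    qed
    show "t a = u a" using uv(1)[of r] ends by (simp add: t_def)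
  qed (use t ab in auto)
  moreover have "t \<in> X"
  proof -
    let ?x = "flip a b \<circ> ?v"
    interpret I: top_splitting a b "inv ` Y" "inv ` X" "inv ?x" by (rule inverse_splitting)
    have inv_x: "inv (inv ?x) = ?x"
      using X_perm[OF flip_in] by (rule permutes_inv_inv)
    \<comment> \<open>Membership in \<open>X\<close> is membership of the inverse in the second
      factor of the inverse splitting, so the same criterion applies. Here \<open>between\<close>
      supplies the inequalities for the inversions of \<open>t\<close>.\<close>
    have "inv t \<in> inv ` X"
    proof (rule I.mem_if_first_eq[OF IH])
      show "inv t permutes ?A" using t by (rule permutes_inv)
      have "?x q = a" using ends ab by (simp add: flip_def)
      then have "inv ?x a = q" using permutes_inverses(2)[OF X_perm[OF flip_in]] by metis
      then show "inv t a = inv ?x a" using ends by (simp add: inv_t t'_def)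
      show "weak_le ?A (inv t) (inv ?x)"
        unfolding weak_le_def inv_x permutes_inv_inv[OF t]
      proof (intro ballI impI)
        fix i j assume ij: "i \<in> ?A" "j \<in> ?A" "i < j" "t j < t i"
        then have "(i = a \<and> j \<noteq> r) \<or> (j = b \<and> i \<noteq> q)"
          using ends q by (auto simp: t_def split: if_splits)
        moreover have "j = q \<or> j = r \<or> j = b \<or> (q < j \<and> j < r)" if "i = a"
          using that ij q r by auto
        moreover have "i = a \<or> i = q \<or> i = r \<or> (q < i \<and> i < r)" if "j = b"
          using that ij q r by auto
        ultimately have "?v i < ?v j"
          using between[of i] between[of j] v_strict[of a] v_strict[of b] ends ab by auto
        then show "?x j < ?x i" using flip_less_iff inv_u_in ij by auto
      qed
    qed (use ab in simp)
    then obtain x where "x \<in> X" "inv t = inv x" by blast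
    then show ?thesis using permutes_inv_inv[OF t] permutes_inv_inv[OF X_perm] by metis
  qed
  \<comment> \<open>Since both factors contain the identity, \<open>t \<circ> id\<close> and
    \<open>id \<circ> t\<close> are two factorizations of \<open>t\<close>.\<close>
  ultimately have "t = id" using unique[of t id id t] id_mem by auto
  then have "t a = a" by simp
  then show False using ends by (simp add: t_def)
qed

end

text \<open>Strong induction on the size of the interval. The pattern 2413 is excluded directly, and
  3142 by applying the same result to the inverse splitting.\<close>

lemma top_splitting_separable:
  assumes "top_splitting a b X Y u"
  shows "separable_on {a..b} (inv u)"
  using assms
proof (induction "card {a..b}" arbitrary: a b X Y u rule: less_induct)
  case less
  interpret top_splitting a b X Y u by fact
  have IH: "proper_subintervals_separable a b"
    unfolding proper_subintervals_separable_def
    using less.hyps psubset_card_mono[OF finite_atLeastAtMost, of _ a b] by blast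
  let ?x = "flip a b \<circ> inv u"
  interpret I: top_splitting a b "inv ` Y" "inv ` X" "inv ?x" by (rule inverse_splitting)
  have "inv (inv ?x) = ?x" using X_perm[OF flip_in] by (rule permutes_inv_inv)
  then have "\<not> pattern_2413 ?x {a..b}" using I.no_pattern_2413[OF IH] by simp
  moreover have "pattern_2413 ?x {a..b}" if pat: "pattern_3142 (inv u) {a..b}"
  proof -
    obtain i j k l where *: "i \<in> {a..b}" "j \<in> {a..b}" "k \<in> {a..b}" "l \<in> {a..b}"
        "i < j" "j < k" "k < l" "inv u j < inv u l" "inv u l < inv u i" "inv u i < inv u k"
      using pat unfolding pattern_3142_def by blast
    then show ?thesis
      unfolding pattern_2413_def
      by (intro bexI[of _ i] bexI[of _ j] bexI[of _ k] bexI[of _ l])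
        (auto simp only: comp_apply flip_less_iff inv_u_in)
  qed
  ultimately show ?case unfolding separable_on_def using no_pattern_2413[OF IH] by blast
qed

section \<open>Transfer to the symmetric group on \<open>{1..n}\<close>\<close>

lemma separable_if_separable_on:
  assumes "separable_on {1..n} u"
  shows "separable n u"
  unfolding separable_def
proof (intro notI, elim exE conjE)
  fix i j k l
  assume ijkl: "1 \<le> i" "i < j" "j < k" "k < l" "l \<le> n"
    and pat: "(u j < u l \<and> u l < u i \<and> u i < u k) \<or> (u k < u i \<and> u i < u l \<and> u l < u j)"
  have "i \<in> {1..n}" "j \<in> {1..n}" "k \<in> {1..n}" "l \<in> {1..n}" using ijkl by auto
  then show False
    using assms ijkl(2-4) pat
    unfolding separable_on_def pattern_2413_def pattern_3142_def by blast
qed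

lemma splitting_imp_interval_splitting:
  assumes "splitting n X Y"
  shows "interval_splitting 1 n X Y"
proof -
  have sub: "X \<subseteq> Sym n" "Y \<subseteq> Sym n" and len: "\<And>x y. x \<in> X \<Longrightarrow> y \<in> Y \<Longrightarrow> len n (x \<circ> y) = len n x + len n y"
    and inj: "inj_on (\<lambda>(x, y). x \<circ> y) (X \<times> Y)" and im: "(\<lambda>(x, y). x \<circ> y) ` (X \<times> Y) = Sym n"
    using assms unfolding splitting_def bij_betw_def by auto
  show ?thesis
  proof
    show "\<exists>x\<in>X. \<exists>y\<in>Y. w = x \<circ> y" if "w permutes {1..n}" for w
    proof -
      have "w \<in> (\<lambda>(x, y). x \<circ> y) ` (X \<times> Y)" using im that by (simp add: Sym_def)
      then show ?thesis by auto
    qed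
    show "x = x' \<and> y = y'"
      if "x \<in> X" "x' \<in> X" "y \<in> Y" "y' \<in> Y" "x \<circ> y = x' \<circ> y'" for x x' y y'
      using inj_onD[OF inj, of "(x, y)" "(x', y')"] that by simp
    show "reduced {1..n} x y" if "x \<in> X" "y \<in> Y" for x y
      using len_comp_iff_reduced[of x n y] len[OF that] that sub by (auto simp: Sym_def)
  qed (use sub in \<open>auto simp: Sym_def\<close>)
qed

theorem theorem4p4:
  fixes n :: nat and X Y :: "(nat \<Rightarrow> nat) set"
  assumes "splitting n X Y"
  shows "X = gen_quotient n Y \<and> (\<exists>u \<in> Sym n. separable n u \<and> Y = right_interval n u)"
proof -
  interpret interval_splitting 1 n X Y
    by (rule splitting_imp_interval_splitting[OF assms])
  obtain u where top: "top_splitting 1 n X Y u" using exists_top by blast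
  then interpret top_splitting 1 n X Y u .
  have sep: "separable_on {1..n} (inv u)" by (rule top_splitting_separable[OF top])
  have id_props: "reduced {1..n} id u" "weak_le {1..n} id u"
    by (auto simp: reduced_def weak_le_def)
  have u: "u \<in> Sym n" using u_perm by (simp add: Sym_def)
  \<comment> \<open>Since \<open>u\<close> lies in \<open>Y\<close>, reducedness against all of
    \<open>Y\<close> includes the bound for \<open>X\<close>. Pairing \<open>x\<close> with
    \<open>id\<close>, which satisfies the bound for \<open>Y\<close>, then yields membership; the
    claim for \<open>Y\<close> is dual.\<close>
  have "X = {x. x permutes {1..n} \<and> (\<forall>y\<in>Y. reduced {1..n} x y)}"
    using X_perm red u_in mem_if_separable(1)[OF sep _ _ permutes_id id_props(2)] by blast
  also have "\<dots> = gen_quotient n Y"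
    using len_comp_iff_reduced Y_perm by (auto simp: gen_quotient_def Sym_def)
  finally have "X = gen_quotient n Y" .
  moreover have "Y = right_interval n u"
    using Y_perm Y_weak_le mem_if_separable(2)[OF sep permutes_id id_props(1)]
    by (auto simp: right_interval_eq[OF u])
  moreover have "separable n u"
    using sep separable_on_inv[OF u_perm] separable_if_separable_on by blast
  ultimately show ?thesis using u by blast
qed

end
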